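(* Let $n\ge 1$, let $A$ be an $n\times n$ matrix with complex entries, and let $T>0$ be a real number with $\Vert A\Vert_2\le T$. Then (i) $|\mathrm{perm}(A)| \le 2T^{n}\exp\Big[-3n\big(1-\tfrac{\sqrt{\pi}}{2}\,h_2(A)/T-(1-\tfrac{\sqrt{\pi}}{2})\,h_\infty(A)/T\big)^2/100\Big]$, and (ii) $|\mathrm{perm}(A)| \le 2T^{n}\exp\big[-n(1-h_\infty(A)/T)^2/10^{5}\big]$.
   Context: The permanent is $\mathrm{perm}(A)=\sum_{\sigma\in S_n}\prod_{i=1}^n a_{i,\sigma(i)}$. $\Vert A\Vert_2=\sup_{\Vert x\Vert_2\le 1, x\in\mathbb{C}^n}\Vert Ax\Vert_2$ is the operator 2-norm. For a matrix $A$ with rows $r_1,\dots,r_n$ and $p\in\{2,\infty\}$, $h_p(A)=\frac1n\sum_{i=1}^n\Vert r_i\Vert_p$, where $\Vert\cdot\Vert_p$ is the usual $\ell_p$ norm of a vector. *)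

theory Defs
  imports "HOL-Analysis.Analysis"
begin

definition perm :: "'a::comm_ring_1^'n^'n \<Rightarrow> 'a" where
  "perm A = (\<Sum>p | p permutes (UNIV :: 'n set). \<Prod>i\<in>UNIV. A $ i $ p i)"

text \<open>The library's \<^const>\<open>infnorm\<close> is not suitable on complex vectors: it takes the
  maximum over real and imaginary parts separately instead of over moduli.\<close>

definition linf_norm :: "complex^'n \<Rightarrow> real" where
  "linf_norm v = Max (range (\<lambda>j. cmod (v $ j)))"

definition h2 :: "complex^'n^'n \<Rightarrow> real" where
  "h2 A = (\<Sum>i\<in>UNIV. norm (row i A)) / real CARD('n)"

definition hinf :: "complex^'n^'n \<Rightarrow> real" where
  "hinf A = (\<Sum>i\<in>UNIV. linf_norm (row i A)) / real CARD('n)"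

text \<open>\<^const>\<open>norm\<close> on \<^typ>\<open>complex^'n\<close> is the Euclidean norm, so the operator 2-norm of \<open>A\<close>
  is \<open>onorm ((*v) A)\<close>; this is the supremum over the complex unit ball.\<close>

lemma onorm_matrix_eq_SUP_unit_ball:
  fixes A :: "complex^'n^'n"
  shows "onorm ((*v) A) = (SUP x\<in>{x. norm x \<le> 1}. norm (A *v x))"
proof -
  have lin: "linear ((*v) A)"
    by (rule linearI) (simp_all add: matrix_vector_right_distrib vec_eq_iff
        matrix_vector_mult_def scaleR_sum_right distrib_left sum.distrib)
  then have bl: "bounded_linear ((*v) A)"
    by (rule linear_conv_bounded_linear[THEN iffD1])
  have le: "norm (A *v x) \<le> onorm ((*v) A)" if "norm x \<le> 1" for x
    using onorm[OF bl, of x] mult_left_mono[OF that onorm_pos_le[OF bl]] by simp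
  have bdd: "bdd_above ((\<lambda>x. norm (A *v x)) ` {x. norm x \<le> 1})"
    using le by (auto intro!: bdd_aboveI)
  show ?thesis
  proof (rule antisym)
    show "(SUP x\<in>{x. norm x \<le> 1}. norm (A *v x)) \<le> onorm ((*v) A)"
      by (rule cSUP_least) (use le in \<open>auto intro: exI[of _ 0]\<close>)
    show "onorm ((*v) A) \<le> (SUP x\<in>{x. norm x \<le> 1}. norm (A *v x))"
      unfolding onorm_def
    proof (rule cSUP_least)
      fix x :: "complex^'n"
      have "norm (A *v x) / norm x = norm (A *v (x /\<^sub>R norm x))"
        by (simp add: linear_cmul[OF lin] divide_inverse mult.commute)
      also have "\<dots> \<le> (SUP x\<in>{x. norm x \<le> 1}. norm (A *v x))"
        by (rule cSUP_upper[OF _ bdd]) (cases "x = 0", simp_all)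
      finally show "norm (A *v x) / norm x \<le> (SUP x\<in>{x. norm x \<le> 1}. norm (A *v x))" .
    qed simp
  qed
qed

end

theory Submission
  imports Defs
begin

text \<open>
  Let the coordinates of \<open>X\<close> be independent and uniform on \<open>(\<plusminus>1 \<plusminus> \<i>) / \<surd>2\<close>. Then
  \<open>perm A = E[\<Prod>\<^sub>j cnj X\<^sub>j \<Prod>\<^sub>i (A X)\<^sub>i]\<close>, so \<open>y \<le> exp (y - 1)\<close> gives
  \<open>\<bar>perm A\<bar> \<le> T\<^sup>n E[exp (n (F - 1))]\<close>, where \<open>F\<close> is the mean of the \<open>\<bar>(A X)\<^sub>i\<bar> / T\<close> and
  \<open>F \<le> 1\<close> by Cauchy--Schwarz. As \<open>F\<close> is convex and \<open>1/\<surd>n\<close>-Lipschitz, Maurey's form of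
  Talagrand's concentration inequality on the cube \<open>{\<plusminus>1}\<^sup>2\<^sup>n\<close> yields
  \<open>E[exp (s F)] \<le> exp (s E[F] + 2 s\<^sup>2/n)\<close>; the choice \<open>s = n (1 - E[F]) / 4 \<le> n\<close> bounds the
  permanent by \<open>T\<^sup>n exp (- n (1 - E[F])\<^sup>2 / 8)\<close>.

  Estimating \<open>\<bar>\<cdot>\<bar>\<close> by a cubic polynomial in \<open>\<bar>\<cdot>\<bar>\<^sup>2\<close> and computing moments up to order six gives
  \<open>E\<bar>\<langle>r, X\<rangle>\<bar> \<le> \<parallel>r\<parallel>\<^sub>2 - (8/125) (\<parallel>r\<parallel>\<^sub>2 - \<parallel>r\<parallel>\<^sub>\<infinity>)\<close>. This is weaker than the sharp Khinchine-type
  inequality with constant \<open>\<surd>\<pi>/2\<close>, but since \<open>1 - \<surd>\<pi>/2 \<le> 16/125\<close> it loses only a factor 2 in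
  \<open>1 - E[F]\<close>, and \<open>1/8 \<cdot> 1/4 > 3/100\<close>.
\<close>

subsection \<open>Averages over the corners of a cube\<close>

text \<open>The expectation of \<open>f\<close> at \<open>z\<close> plus a randomly signed sum of
  the steps, with independent fair signs. Recursion on the base point lets an induction condition on
  one sign at a time.\<close>

primrec cube_avg :: "'a::real_vector list \<Rightarrow> ('a \<Rightarrow> 'b::real_vector) \<Rightarrow> 'a \<Rightarrow> 'b" where
  "cube_avg [] f z = f z"
| "cube_avg (v # vs) f z = (1/2) *\<^sub>R (cube_avg vs f (z + v) + cube_avg vs f (z - v))"

text \<open>The support of that random point; facts that hold only there may be used under the
  average.\<close>

primrec corners :: "'a::real_vector list \<Rightarrow> 'a \<Rightarrow> 'a set" where
  "corners [] z = {z}"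
| "corners (v # vs) z = corners vs (z + v) \<union> corners vs (z - v)"

lemma cube_avg_cong:
  "(\<And>x. x \<in> corners vs z \<Longrightarrow> f x = g x) \<Longrightarrow> cube_avg vs f z = cube_avg vs g z"
proof (induction vs arbitrary: z)
  case (Cons v vs)
  have "cube_avg vs f (z + v) = cube_avg vs g (z + v)" "cube_avg vs f (z - v) = cube_avg vs g (z - v)"
    by (rule Cons.IH; simp add: Cons.prems)+
  then show ?case by simp
qed simp

lemma cube_avg_mono:
  fixes f g :: "'a::real_vector \<Rightarrow> real"
  shows "(\<And>x. x \<in> corners vs z \<Longrightarrow> f x \<le> g x) \<Longrightarrow> cube_avg vs f z \<le> cube_avg vs g z"
proof (induction vs arbitrary: z)
  case (Cons v vs)
  have "cube_avg vs f (z + v) \<le> cube_avg vs g (z + v)" "cube_avg vs f (z - v) \<le> cube_avg vs g (z - v)"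
    by (rule Cons.IH; simp add: Cons.prems)+
  then show ?case by simp
qed simp

lemma cube_avg_const [simp]: "cube_avg vs (\<lambda>_. c) z = c"
  by (induction vs arbitrary: z) (simp_all flip: scaleR_2)

lemma cube_avg_add: "cube_avg vs (\<lambda>x. f x + g x) z = cube_avg vs f z + cube_avg vs g z"
  by (induction vs arbitrary: z) (simp_all add: algebra_simps)

lemma cube_avg_linear:
  assumes "linear L"
  shows "cube_avg vs (\<lambda>x. L (f x)) z = L (cube_avg vs f z)"
  by (induction vs arbitrary: z) (simp_all add: linear_add[OF assms] linear_cmul[OF assms])

lemma cube_avg_mult_left:
  fixes c :: "'b::real_algebra"
  shows "cube_avg vs (\<lambda>x. c * f x) z = c * cube_avg vs f z"
  by (rule cube_avg_linear) (simp add: linear_iff algebra_simps)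

lemma cube_avg_minus: "cube_avg vs (\<lambda>x. - f x) z = - cube_avg vs f z"
  by (rule cube_avg_linear) (simp add: linear_iff)

lemma cube_avg_sum:
  "cube_avg vs (\<lambda>x. \<Sum>i\<in>I. f i x) z = (\<Sum>i\<in>I. cube_avg vs (f i) z)"
  by (induction I rule: infinite_finite_induct) (simp_all add: cube_avg_add)

lemma norm_cube_avg_le:
  fixes f :: "'a::real_vector \<Rightarrow> 'b::real_normed_vector"
  shows "norm (cube_avg vs f z) \<le> cube_avg vs (\<lambda>x. norm (f x)) z"
proof (induction vs arbitrary: z)
  case (Cons v vs)
  have "norm (cube_avg vs f (z + v) + cube_avg vs f (z - v))
      \<le> cube_avg vs (\<lambda>x. norm (f x)) (z + v) + cube_avg vs (\<lambda>x. norm (f x)) (z - v)"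
    using Cons.IH by (meson add_mono norm_triangle_le)
  then show ?case by simp
qed simp

lemma cube_avg_translate: "cube_avg vs (\<lambda>x. f (x + w)) z = cube_avg vs f (z + w)"
  by (induction vs arbitrary: z) (simp_all add: algebra_simps)

text \<open>Reversing some of the steps only relabels the sign patterns. Averages at 0 of integrands
  odd under \<open>R\<close> therefore vanish.\<close>

lemma cube_avg_reflect:
  assumes "linear R" and "\<And>v. v \<in> set vs \<Longrightarrow> R v = v \<or> R v = - v"
  shows "cube_avg vs (\<lambda>x. f (R x)) z = cube_avg vs f (R z)"
  using assms(2)
proof (induction vs arbitrary: z)
  case (Cons v vs)
  have IH: "cube_avg vs (\<lambda>x. f (R x)) z' = cube_avg vs f (R z')" for z'
    by (rule Cons.IH) (simp add: Cons.prems)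
  consider "R v = v" | "R v = - v" using Cons.prems[of v] by auto
  then show ?case
    by cases (simp_all add: IH linear_add[OF assms(1)] linear_diff[OF assms(1)] add.commute)
qed simp

text \<open>The recursion puts the first sign outermost; here it is averaged out first,
  conditionally on all the others.\<close>

lemma cube_avg_Cons_inner:
  fixes f :: "'a::real_vector \<Rightarrow> 'b::real_vector"
  shows
  "cube_avg (v # vs) f z = cube_avg vs (\<lambda>x. (1/2) *\<^sub>R (f (x + v) + f (x - v))) z"
proof -
  have "linear (\<lambda>y::'b. (1/2) *\<^sub>R y)" by (simp add: linear_iff algebra_simps)
  from cube_avg_linear[OF this, of vs "\<lambda>x. f (x + v) + f (x - v)" z] show ?thesis
    using cube_avg_translate[of vs f v z] cube_avg_translate[of vs f "- v" z]
    by (simp add: cube_avg_add)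
qed

section \<open>Jensen and Hoelder for averages of exponentials\<close>

lemma cube_avg_exp_pos: "0 < cube_avg vs (\<lambda>x. exp (g x :: real)) z"
  by (induction vs arbitrary: z) (simp_all add: add_pos_pos)

text \<open>The tangent of \<open>exp\<close> at the mean lies below \<open>exp\<close>, and its
  average is the value at the mean.\<close>

lemma cube_avg_exp_Jensen: "exp (cube_avg vs g z) \<le> cube_avg vs (\<lambda>x. exp (g x :: real)) z"
proof -
  define m where "m = cube_avg vs g z"
  have "exp m = cube_avg vs (\<lambda>x. exp m * (1 - m + g x)) z"
    by (simp add: cube_avg_mult_left cube_avg_add m_def)
  also have "\<dots> \<le> cube_avg vs (\<lambda>x. exp (g x)) z"
  proof (rule cube_avg_mono)
    fix x
    have "1 - m + g x \<le> exp (g x - m)" using exp_ge_add_one_self[of "g x - m"] by linarith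
    then have "exp m * (1 - m + g x) \<le> exp m * exp (g x - m)" by simp
    then show "exp m * (1 - m + g x) \<le> exp (g x)" by (simp flip: exp_add)
  qed
  finally show ?thesis unfolding m_def .
qed

text \<open>Hoelder's inequality, the right-hand side being a weighted geometric mean. Once both
  exponentials are normalised to average 1, it is pointwise convexity of \<open>exp\<close>.\<close>

lemma cube_avg_exp_Hoelder:
  fixes g h :: "'a::real_vector \<Rightarrow> real"
  assumes "0 \<le> t" "t \<le> 1"
  shows "cube_avg vs (\<lambda>x. exp ((1 - t) * g x + t * h x)) z
    \<le> exp ((1 - t) * ln (cube_avg vs (\<lambda>x. exp (g x)) z) + t * ln (cube_avg vs (\<lambda>x. exp (h x)) z))"
proof -
  define a where "a = cube_avg vs (\<lambda>x. exp (g x)) z"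
  define b where "b = cube_avg vs (\<lambda>x. exp (h x)) z"
  have pos: "a > 0" "b > 0" unfolding a_def b_def by (rule cube_avg_exp_pos)+
  define E where "E = exp ((1 - t) * ln a + t * ln b)"
  have "cube_avg vs (\<lambda>x. exp ((1 - t) * g x + t * h x)) z
      \<le> cube_avg vs (\<lambda>x. (E * ((1 - t) / a)) * exp (g x) + (E * (t / b)) * exp (h x)) z"
  proof (rule cube_avg_mono)
    fix x
    have "exp ((1 - t) *\<^sub>R (g x - ln a) + t *\<^sub>R (h x - ln b))
        \<le> (1 - t) * exp (g x - ln a) + t * exp (h x - ln b)"
      using convex_onD[OF exp_convex, of t] assms by simp
    then have "E * exp ((1 - t) * (g x - ln a) + t * (h x - ln b))
        \<le> E * ((1 - t) * (exp (g x) / a) + t * (exp (h x) / b))"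
      using pos by (simp add: exp_diff E_def)
    moreover have "E * exp ((1 - t) * (g x - ln a) + t * (h x - ln b)) = exp ((1 - t) * g x + t * h x)"
      unfolding E_def by (simp add: algebra_simps flip: exp_add)
    ultimately show "exp ((1 - t) * g x + t * h x)
        \<le> (E * ((1 - t) / a)) * exp (g x) + (E * (t / b)) * exp (h x)"
      by (simp add: algebra_simps)
  qed
  also have "\<dots> = E * ((1 - t) / a) * a + E * (t / b) * b"
    unfolding cube_avg_add cube_avg_mult_left a_def b_def ..
  also have "\<dots> = E" using pos by (simp flip: distrib_left)
  finally show ?thesis unfolding E_def a_def b_def .
qed

subsection \<open>Convex concentration on the cube\<close>

text \<open>The exponent is minimal at \<open>t = 2 * u\<close>, with value
  \<open>u - u\<^sup>2\<close>. This is admissible for \<open>u \<le> 1/2\<close>; beyond that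
  \<open>t = 1\<close> suffices, because \<open>exp (1/4) \<le> 21/16 < 4/3\<close>.\<close>

lemma interpolation_exponent:
  fixes u :: real
  assumes "u \<ge> 0"
  shows "\<exists>t\<in>{0..1}. exp ((1 - t) * u + t\<^sup>2 / 4) \<le> 2 - exp (- u)"
proof (cases "u \<le> 1/2")
  case True
  \<comment> \<open>Since \<open>\<phi> 0 = 2\<close>, the claim for the minimal exponent says that
    \<open>\<phi>\<close> does not exceed its initial value.\<close>
  define \<phi> where "\<phi> x = exp (x - x\<^sup>2) + exp (- x)" for x :: real
  have "\<phi> u \<le> \<phi> 0"
  proof (rule DERIV_nonpos_imp_nonincreasing[OF assms])
    fix x :: real assume "0 \<le> x" "x \<le> u"
    have der: "(\<phi> has_real_derivative ((1 - 2 * x) * exp (x - x\<^sup>2) - exp (- x))) (at x)"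
      unfolding \<phi>_def by (auto intro!: derivative_eq_intros simp: algebra_simps)
    have "(1 - 2 * x) * exp (x - x\<^sup>2) \<le> exp (- 2 * x) * exp (x - x\<^sup>2)"
      using exp_ge_add_one_self[of "- 2 * x"] by (intro mult_right_mono) auto
    also have "\<dots> \<le> exp (- x)" by (simp flip: exp_add)
    finally show "\<exists>y. DERIV \<phi> x :> y \<and> y \<le> 0" using der by auto
  qed
  then have "exp (u - u\<^sup>2) \<le> 2 - exp (- u)" by (simp add: \<phi>_def)
  moreover have "(1 - 2 * u) * u + (2 * u)\<^sup>2 / 4 = u - u\<^sup>2"
    by (simp add: algebra_simps power2_eq_square)
  ultimately have "exp ((1 - 2 * u) * u + (2 * u)\<^sup>2 / 4) \<le> 2 - exp (- u)" by metis
  then show ?thesis using True assms by (intro bexI[of _ "2 * u"]) simp_all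
next
  case False
  have "exp (- u) \<le> exp (- (1/2))" using False by simp
  also have "\<dots> \<le> 1 / (1 + 1/2)"
    using exp_ge_add_one_self[of "1/2::real"] by (simp add: exp_minus divide_simps)
  finally have "exp (- u) \<le> 2/3" by simp
  moreover have "exp (1/4::real) \<le> 1 + 1/4 + (1/4)\<^sup>2" by (rule exp_bound) auto
  ultimately have "exp (1/4) \<le> 2 - exp (- u)" by (simp add: power2_eq_square)
  then show ?thesis by (intro bexI[of _ 1]) auto
qed

lemma le_mult_INF_I:
  fixes F :: "'a \<Rightarrow> real"
  assumes "t \<ge> 0" "S \<noteq> {}" "\<And>y. y \<in> S \<Longrightarrow> b \<le> t * F y + k"
  shows "b \<le> t * (INF y\<in>S. F y) + k"
proof (cases "t = 0")
  case True
  then show ?thesis using assms by auto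
next
  case False
  then have "(b - k) / t \<le> (INF y\<in>S. F y)"
    using assms by (intro cINF_greatest) (auto simp: field_simps)
  then show ?thesis using False assms(1) by (simp add: field_simps)
qed

text \<open>\<open>Q\<close> is the infimal convolution over the remaining directions. Displacing
  \<open>x\<close> by a convex combination of \<open>y1\<close> and \<open>y2\<close> minus
  \<open>(2 * t) *\<^sub>R v\<close> lands on the segment from \<open>x + y1\<close> to
  \<open>x - 2 *\<^sub>R v + y2\<close>, so convexity of \<open>f\<close> applies; by orthogonality
  the move along the edge costs \<open>4 * c * t\<^sup>2 * (norm v)\<^sup>2\<close>, at most
  \<open>t\<^sup>2 / 4\<close>.\<close>

lemma infconv_step:
  fixes f :: "'a::real_inner \<Rightarrow> real"
  assumes conv: "convex_on UNIV f"
    and orth: "\<And>w. w \<in> set vs \<Longrightarrow> v \<bullet> w = 0" and len: "16 * c * (norm v)\<^sup>2 \<le> 1" and c: "c \<ge> 0"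
    and g: "\<And>x y. y \<in> span (insert v (set vs)) \<Longrightarrow> g x \<le> f (x + y) + c * (norm y)\<^sup>2"
    and t: "0 \<le> t" "t \<le> 1"
  defines "Q \<equiv> \<lambda>x. INF y\<in>span (set vs). f (x + y) + c * (norm y)\<^sup>2"
  shows "g x \<le> (1 - t) * Q x + t * Q (x - 2 *\<^sub>R v) + t\<^sup>2 / 4"
proof -
  define F where "F x y = f (x + y) + c * (norm y)\<^sup>2" for x y
  have key: "g x \<le> t * F (x - 2 *\<^sub>R v) y2 + ((1 - t) * F x y1 + t\<^sup>2 / 4)"
    if y: "y1 \<in> span (set vs)" "y2 \<in> span (set vs)" for y1 y2
  proof -
    define w where "w = (1 - t) *\<^sub>R y1 + t *\<^sub>R y2"
    have w: "w \<in> span (set vs)" unfolding w_def using y by (intro span_add span_scale)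
    have "v \<bullet> w = 0"
      using w by (induction rule: span_induct_alt) (auto simp: inner_simps orth)
    then have vw: "w \<bullet> v = 0" by (simp add: inner_commute)
    have n1: "(norm (w - (2 * t) *\<^sub>R v))\<^sup>2 = (norm w)\<^sup>2 + 4 * t\<^sup>2 * (norm v)\<^sup>2"
    proof -
      have "orthogonal w ((- 2 * t) *\<^sub>R v)" using vw by (simp add: orthogonal_def)
      from norm_add_Pythagorean[OF this] show ?thesis by (simp add: power_mult_distrib)
    qed
    have n2: "(norm w)\<^sup>2 \<le> (1 - t) * (norm y1)\<^sup>2 + t * (norm y2)\<^sup>2"
    proof -
      have "(1 - t) * (norm y1)\<^sup>2 + t * (norm y2)\<^sup>2 - (norm w)\<^sup>2 = t * (1 - t) * (norm (y1 - y2))\<^sup>2"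
        unfolding w_def
        by (simp add: power2_norm_eq_inner inner_add_left inner_add_right inner_diff_left
            inner_diff_right inner_commute[of y2 y1] algebra_simps)
      then show ?thesis using t by (smt (verit) mult_nonneg_nonneg zero_le_power2)
    qed
    have "w - (2 * t) *\<^sub>R v \<in> span (insert v (set vs))"
      using w span_mono[of "set vs" "insert v (set vs)"]
      by (intro span_diff span_scale) (auto intro: span_base)
    from g[OF this] have "g x \<le> f (x + (w - (2 * t) *\<^sub>R v)) + c * (norm (w - (2 * t) *\<^sub>R v))\<^sup>2" .
    also have "x + (w - (2 * t) *\<^sub>R v) = (1 - t) *\<^sub>R (x + y1) + t *\<^sub>R (x - 2 *\<^sub>R v + y2)"
      unfolding w_def by (simp add: algebra_simps)
    also have "f \<dots> \<le> (1 - t) * f (x + y1) + t * f (x - 2 *\<^sub>R v + y2)"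
      using convex_onD[OF conv, of t] t by simp
    also have "c * (norm (w - (2 * t) *\<^sub>R v))\<^sup>2
        \<le> c * ((1 - t) * (norm y1)\<^sup>2 + t * (norm y2)\<^sup>2 + 4 * t\<^sup>2 * (norm v)\<^sup>2)"
      unfolding n1 using n2 c by (intro mult_left_mono) auto
    also have "\<dots> \<le> c * ((1 - t) * (norm y1)\<^sup>2 + t * (norm y2)\<^sup>2) + t\<^sup>2 / 4"
      using mult_left_mono[OF len, of "t\<^sup>2 / 4"] by (simp add: algebra_simps)
    finally show ?thesis unfolding F_def by (simp add: algebra_simps)
  qed
  have ne: "span (set vs) \<noteq> {}" using span_zero by blast
  have Q: "Q x = (INF y\<in>span (set vs). F x y)" for x unfolding Q_def F_def ..
  \<comment> \<open>The infimum is taken over \<open>y2\<close> with \<open>y1\<close> fixed, and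
    only then over \<open>y1\<close>.\<close>
  have "g x \<le> t * Q (x - 2 *\<^sub>R v) + ((1 - t) * F x y1 + t\<^sup>2 / 4)" if "y1 \<in> span (set vs)" for y1
    unfolding Q by (rule le_mult_INF_I[OF t(1) ne]) (use key that in auto)
  then have "g x \<le> (1 - t) * F x y1 + (t * Q (x - 2 *\<^sub>R v) + t\<^sup>2 / 4)" if "y1 \<in> span (set vs)" for y1
    using that by (simp add: algebra_simps)
  then have "g x \<le> (1 - t) * Q x + (t * Q (x - 2 *\<^sub>R v) + t\<^sup>2 / 4)"
    unfolding Q[of x] using t by (intro le_mult_INF_I[OF _ ne]) auto
  then show ?thesis by simp
qed

text \<open>The scalar core of the induction over the cube. The indices stand for two opposite
  faces, with averages \<open>a\<^sub>i\<close> of \<open>exp Q\<close> and \<open>v\<^sub>i\<close>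
  of \<open>exp (- f)\<close>; \<open>p\<close> and \<open>q\<close> are the averages of
  \<open>exp g\<close>. On the face with the smaller \<open>v\<^sub>i\<close> the bound is
  interpolated towards the other face, where the direct bound is enough.\<close>

lemma two_point_combination:
  fixes a\<^sub>1 a\<^sub>2 v\<^sub>1 v\<^sub>2 p q :: real
  assumes pos: "v\<^sub>1 > 0" "v\<^sub>2 > 0" "a\<^sub>1 > 0" "a\<^sub>2 > 0" and le: "a\<^sub>1 * v\<^sub>1 \<le> 1" "a\<^sub>2 * v\<^sub>2 \<le> 1" and v: "v\<^sub>1 \<le> v\<^sub>2"
    and p: "\<And>t. 0 \<le> t \<Longrightarrow> t \<le> 1 \<Longrightarrow> p \<le> exp ((1 - t) * ln a\<^sub>1 + t * ln a\<^sub>2 + t\<^sup>2 / 4)"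
    and q: "q \<le> a\<^sub>2"
  shows "(p + q) / 2 * ((v\<^sub>1 + v\<^sub>2) / 2) \<le> 1"
proof -
  define u where "u = ln v\<^sub>2 - ln v\<^sub>1"
  have "u \<ge> 0" using v pos by (simp add: u_def)
  then obtain t where t: "t \<in> {0..1}" and ht: "exp ((1 - t) * u + t\<^sup>2 / 4) \<le> 2 - exp (- u)"
    using interpolation_exponent by blast
  \<comment> \<open>Replacing each \<open>a\<^sub>i\<close> by its upper bound
    \<open>1 / v\<^sub>i\<close> makes the estimate depend, up to scaling, only on the ratio of the
    \<open>v\<^sub>i\<close>.\<close>
  have l: "ln a\<^sub>1 \<le> - ln v\<^sub>1" "ln a\<^sub>2 \<le> - ln v\<^sub>2"
    using le pos ln_mult[of a\<^sub>1 v\<^sub>1] ln_mult[of a\<^sub>2 v\<^sub>2]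
      ln_le_zero_iff[of "a\<^sub>1 * v\<^sub>1"] ln_le_zero_iff[of "a\<^sub>2 * v\<^sub>2"] by auto
  have eu: "exp (- u) = v\<^sub>1 / v\<^sub>2" using pos by (simp add: u_def exp_diff)
  have "(1 - t) * ln a\<^sub>1 + t * ln a\<^sub>2 \<le> (1 - t) * (- ln v\<^sub>1) + t * (- ln v\<^sub>2)"
    using l t by (intro add_mono mult_left_mono) auto
  then have expo: "(1 - t) * ln a\<^sub>1 + t * ln a\<^sub>2 + t\<^sup>2 / 4 \<le> ((1 - t) * u + t\<^sup>2 / 4) - ln v\<^sub>2"
    by (simp add: u_def algebra_simps)
  have "p \<le> exp ((1 - t) * ln a\<^sub>1 + t * ln a\<^sub>2 + t\<^sup>2 / 4)" using p t by simp
  also have "\<dots> \<le> exp (((1 - t) * u + t\<^sup>2 / 4) - ln v\<^sub>2)" using expo by simp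
  also have "\<dots> = exp ((1 - t) * u + t\<^sup>2 / 4) / v\<^sub>2" using pos by (simp add: exp_diff)
  also have "\<dots> \<le> (2 - v\<^sub>1 / v\<^sub>2) / v\<^sub>2" using ht eu pos by (simp add: divide_right_mono)
  finally have p': "p \<le> (2 - v\<^sub>1 / v\<^sub>2) / v\<^sub>2" by simp
  have q': "q \<le> 1 / v\<^sub>2" using q le pos by (smt (verit) pos_le_divide_eq)
  have "(p + q) / 2 * ((v\<^sub>1 + v\<^sub>2) / 2) \<le> ((2 - v\<^sub>1 / v\<^sub>2) / v\<^sub>2 + 1 / v\<^sub>2) / 2 * ((v\<^sub>1 + v\<^sub>2) / 2)"
    using p' q' pos by (intro mult_right_mono divide_right_mono add_mono) auto
  also have "\<dots> = (3 - v\<^sub>1 / v\<^sub>2) * (1 + v\<^sub>1 / v\<^sub>2) / 4" using pos by (simp add: field_simps)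
  also have "\<dots> = 1 - (1 - v\<^sub>1 / v\<^sub>2)\<^sup>2 / 4" by (simp only: power2_eq_square) algebra
  also have "\<dots> \<le> 1" by simp
  finally show ?thesis .
qed

lemma cube_infconv_inequality:
  fixes f :: "'a::real_inner \<Rightarrow> real"
  assumes conv: "convex_on UNIV f" and bdd: "\<And>x. B \<le> f x" and c: "c \<ge> 0"
    and orth: "sorted_wrt (\<lambda>v w. v \<bullet> w = 0) vs"
    and len: "\<And>v. v \<in> set vs \<Longrightarrow> 16 * c * (norm v)\<^sup>2 \<le> 1"
    and g: "\<And>x y. y \<in> span (set vs) \<Longrightarrow> g x \<le> f (x + y) + c * (norm y)\<^sup>2"
  shows "cube_avg vs (\<lambda>x. exp (g x)) z * cube_avg vs (\<lambda>x. exp (- f x)) z \<le> 1"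
  using orth len g
proof (induction vs arbitrary: g z)
  case Nil
  have "g z \<le> f z" using Nil(3)[of 0 z] by (simp add: span_zero)
  then show ?case by (simp flip: exp_add)
next
  case (Cons v vs)
  define Q where "Q x = (INF y\<in>span (set vs). f (x + y) + c * (norm y)\<^sup>2)" for x
  have Q_le: "Q x \<le> f (x + y) + c * (norm y)\<^sup>2" if "y \<in> span (set vs)" for x y
    unfolding Q_def
  proof (rule cINF_lower[OF _ that])
    show "bdd_below ((\<lambda>y. f (x + y) + c * (norm y)\<^sup>2) ` span (set vs))"
      by (rule bdd_belowI[of _ B]) (use bdd c in \<open>auto intro: add_increasing2\<close>)
  qed
  have orth: "v \<bullet> w = 0" "(- v) \<bullet> w = 0" if "w \<in> set vs" for w using Cons.prems(1) that by auto
  have len: "16 * c * (norm v)\<^sup>2 \<le> 1" "16 * c * (norm (- v))\<^sup>2 \<le> 1" using Cons.prems(2)[of v] by auto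
  have "insert v (set vs) \<subseteq> span (insert (- v) (set vs))" "insert (- v) (set vs) \<subseteq> span (insert v (set vs))"
    using span_neg[of "- v" "insert (- v) (set vs)"] span_neg[of v "insert v (set vs)"]
    by (auto intro: span_base)
  then have span_minus: "span (insert (- v) (set vs)) = span (insert v (set vs))"
    by (simp add: span_minimal subset_antisym)
  \<comment> \<open>Both orientations of the edge occur, since either half of the cube may have the
    smaller average of \<open>exp (- f)\<close>.\<close>
  have step: "g x \<le> (1 - t) * Q x + t * Q (x - 2 *\<^sub>R v) + t\<^sup>2 / 4"
    "g x \<le> (1 - t) * Q x + t * Q (x + 2 *\<^sub>R v) + t\<^sup>2 / 4" if "0 \<le> t" "t \<le> 1" for t x
  proof -
    show "g x \<le> (1 - t) * Q x + t * Q (x - 2 *\<^sub>R v) + t\<^sup>2 / 4"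
      unfolding Q_def
      by (rule infconv_step[OF conv orth(1) len(1) c _ that]) (use Cons.prems(3) in auto)
    have "g x \<le> (1 - t) * Q x + t * Q (x - 2 *\<^sub>R (- v)) + t\<^sup>2 / 4"
      unfolding Q_def
      by (rule infconv_step[OF conv orth(2) len(2) c _ that])
        (use Cons.prems(3) span_minus in auto)
    then show "g x \<le> (1 - t) * Q x + t * Q (x + 2 *\<^sub>R v) + t\<^sup>2 / 4" by simp
  qed
  define a where "a z = cube_avg vs (\<lambda>x. exp (Q x)) z" for z
  define b where "b z = cube_avg vs (\<lambda>x. exp (- f x)) z" for z
  define e where "e z = cube_avg vs (\<lambda>x. exp (g x)) z" for z
  have pos: "a z > 0" "b z > 0" for z unfolding a_def b_def by (rule cube_avg_exp_pos)+
  have ab: "a z * b z \<le> 1" for z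
    unfolding a_def b_def using Cons.prems Q_le by (intro Cons.IH) auto
  have mix: "e z \<le> exp ((1 - t) * ln (a z) + t * ln (a (z + w)) + t\<^sup>2 / 4)"
    if "\<And>x. g x \<le> (1 - t) * Q x + t * Q (x + w) + t\<^sup>2 / 4" "0 \<le> t" "t \<le> 1" for t z w
  proof -
    have "e z \<le> cube_avg vs (\<lambda>x. exp (t\<^sup>2 / 4) * exp ((1 - t) * Q x + t * Q (x + w))) z"
      unfolding e_def by (rule cube_avg_mono) (use that(1) in \<open>simp add: add.commute flip: exp_add\<close>)
    also have "\<dots> \<le> exp (t\<^sup>2 / 4) * exp ((1 - t) * ln (a z) + t * ln (a (z + w)))"
      using cube_avg_exp_Hoelder[OF that(2,3), of vs Q "\<lambda>x. Q (x + w)" z]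
      by (simp add: cube_avg_mult_left a_def cube_avg_translate[of vs "\<lambda>x. exp (Q x)"])
    finally show ?thesis by (simp add: exp_add mult.commute)
  qed
  \<comment> \<open>The choice \<open>t = 0\<close> compares each half with itself.\<close>
  have ea: "e z \<le> a z" for z
    using mix[of 0 0 z] step(1)[of 0] pos by simp
  have "(e (z + v) + e (z - v)) / 2 * ((b (z + v) + b (z - v)) / 2) \<le> 1"
  proof (cases "b (z + v) \<le> b (z - v)")
    case True
    have "e (z + v) \<le> exp ((1 - t) * ln (a (z + v)) + t * ln (a (z - v)) + t\<^sup>2 / 4)"
      if "0 \<le> t" "t \<le> 1" for t
      using mix[of t "- 2 *\<^sub>R v" "z + v"] step(1)[OF that] that
      by (simp add: algebra_simps scaleR_2)
    with True show ?thesis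
      by (intro two_point_combination[where a\<^sub>1 = "a (z + v)" and a\<^sub>2 = "a (z - v)"] pos ab ea) auto
  next
    case False
    have "e (z - v) \<le> exp ((1 - t) * ln (a (z - v)) + t * ln (a (z + v)) + t\<^sup>2 / 4)"
      if "0 \<le> t" "t \<le> 1" for t
      using mix[of t "2 *\<^sub>R v" "z - v"] step(2)[OF that] that
      by (simp add: algebra_simps scaleR_2)
    with False have "(e (z - v) + e (z + v)) / 2 * ((b (z - v) + b (z + v)) / 2) \<le> 1"
      by (intro two_point_combination[where a\<^sub>1 = "a (z - v)" and a\<^sub>2 = "a (z + v)"] pos ab ea) auto
    then show ?thesis by (simp add: add.commute)
  qed
  then show ?case by (simp add: e_def b_def)
qed

subsection \<open>The permanent as an average\<close>

text \<open>Two real-orthogonal steps per complex coordinate: their signs produce the four values of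
  a coordinate of \<open>X\<close>. The list argument allows induction over the coordinates.\<close>

definition directions :: "'n list \<Rightarrow> (complex^'n) list" where
  "directions js = concat (map (\<lambda>j. [axis j (complex_of_real (1 / sqrt 2)),
     axis j (\<i> * complex_of_real (1 / sqrt 2))]) js)"

lemma directions_simps [simp]:
  "directions [] = []"
  "directions (j # js) = axis j (complex_of_real (1 / sqrt 2)) #
     axis j (\<i> * complex_of_real (1 / sqrt 2)) # directions js"
  by (simp_all add: directions_def)

lemma set_directions:
  "set (directions js) = (\<Union>j\<in>set js. {axis j (complex_of_real (1 / sqrt 2)),
     axis j (\<i> * complex_of_real (1 / sqrt 2))})"
  by (auto simp: directions_def)

lemma axis_inner_axis: "axis i x \<bullet> axis j y = (if i = j then x \<bullet> y else 0)"
  by (simp add: inner_axis) (simp add: axis_def)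

lemma directions_orthogonal:
  "distinct js \<Longrightarrow> sorted_wrt (\<lambda>v w. v \<bullet> w = 0) (directions js)"
  by (induction js) (auto simp: set_directions axis_inner_axis inner_complex_def)

lemma norm_directions:
  assumes "v \<in> set (directions js)"
  shows "(norm v)\<^sup>2 = 1/2"
  using assms
  by (auto simp: set_directions power2_norm_eq_inner axis_inner_axis)
    (auto simp: norm_divide power_divide simp flip: power2_norm_eq_inner)

lemma cmod_sqrt2_combination:
  assumes "\<bar>s\<bar> = 1" "\<bar>t\<bar> = 1"
  shows "cmod (complex_of_real (s / sqrt 2) + \<i> * complex_of_real (t / sqrt 2)) = 1"
proof -
  have "s\<^sup>2 = 1" "t\<^sup>2 = 1" using assms by (metis one_power2 power2_abs)+
  then show ?thesis by (simp add: cmod_def power_divide)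
qed

lemma corners_directions:
  assumes "distinct js" "x \<in> corners (directions js) z"
  shows "(\<forall>j\<in>set js. cmod (x $ j - z $ j) = 1) \<and> (\<forall>j. j \<notin> set js \<longrightarrow> x $ j = z $ j)"
  using assms
proof (induction js arbitrary: z)
  case (Cons j js)
  define a where "a = axis j (complex_of_real (1 / sqrt 2))"
  define b where "b = axis j (\<i> * complex_of_real (1 / sqrt 2))"
  \<comment> \<open>Both signs are consumed at once, because modulus 1 is reached only after the
    real and the imaginary step.\<close>
  obtain s t :: real where st: "\<bar>s\<bar> = 1" "\<bar>t\<bar> = 1"
    and x: "x \<in> corners (directions js) (z + s *\<^sub>R a + t *\<^sub>R b)"
  proof -
    have "x \<in> corners (directions js) (z + 1 *\<^sub>R a + 1 *\<^sub>R b) \<or> x \<in> corners (directions js) (z + 1 *\<^sub>R a + (-1) *\<^sub>R b)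
      \<or> x \<in> corners (directions js) (z + (-1) *\<^sub>R a + 1 *\<^sub>R b) \<or> x \<in> corners (directions js) (z + (-1) *\<^sub>R a + (-1) *\<^sub>R b)"
      using Cons.prems(2) by (simp add: a_def b_def)
    then show ?thesis using that[of 1 1] that[of 1 "-1"] that[of "-1" 1] that[of "-1" "-1"] by auto
  qed
  have IH: "\<forall>k\<in>set js. cmod (x $ k - (z + s *\<^sub>R a + t *\<^sub>R b) $ k) = 1"
    "\<forall>k. k \<notin> set js \<longrightarrow> x $ k = (z + s *\<^sub>R a + t *\<^sub>R b) $ k"
    using Cons.IH[OF _ x] Cons.prems(1) by auto
  have other: "(z + s *\<^sub>R a + t *\<^sub>R b) $ k = z $ k" if "k \<noteq> j" for k
    using that by (simp add: a_def b_def axis_def)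
  have "x $ j = z $ j + (complex_of_real (s / sqrt 2) + \<i> * complex_of_real (t / sqrt 2))"
    using IH(2) Cons.prems(1) by (simp add: a_def b_def axis_def scaleR_conv_of_real[where 'a = complex] algebra_simps)
  then have "cmod (x $ j - z $ j) = 1"
    using cmod_sqrt2_combination[OF st] by simp
  with IH other Cons.prems(1) show ?case by (metis insert_iff list.simps(15) distinct.simps(2))
qed simp

lemma ex_enumeration: "\<exists>js::'n::finite list. distinct js \<and> set js = UNIV"
  using finite_distinct_list[of "UNIV :: 'n set"] by auto

text \<open>Expanding the product of row forms gives a sum over all maps \<open>p\<close> of the
  index set. Permutations contribute 1 because coordinates have modulus 1. Any other map misses some
  \<open>k\<close>, and flipping the sign of coordinate \<open>k\<close> negates its term.\<close>

lemma perm_eq_cube_avg: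
  fixes A :: "complex^'n^'n"
  assumes js: "distinct js" "set js = (UNIV :: 'n set)"
  shows "perm A = cube_avg (directions js) (\<lambda>x. (\<Prod>j\<in>UNIV. cnj (x $ j)) * (\<Prod>i\<in>UNIV. (A *v x) $ i)) 0"
proof -
  define m where "m p x = (\<Prod>j\<in>UNIV. cnj (x $ j)) * (\<Prod>i\<in>UNIV. x $ p i)" for p :: "'n \<Rightarrow> 'n" and x :: "complex^'n"
  have unit: "cnj (x $ j) * x $ j = 1" if "x \<in> corners (directions js) 0" for x j
  proof -
    have "cmod (x $ j) = 1" using corners_directions[OF js(1) that] js(2) by simp
    then show ?thesis by (simp add: complex_norm_square[symmetric] mult.commute)
  qed
  have perm_term: "cube_avg (directions js) (m p) 0 = 1" if "p permutes UNIV" for p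
  proof -
    have "m p x = 1" if x: "x \<in> corners (directions js) 0" for x
    proof -
      have "(\<Prod>i\<in>UNIV. x $ p i) = (\<Prod>j\<in>UNIV. x $ j)"
        using \<open>p permutes UNIV\<close> by (intro prod.reindex_bij_betw permutes_imp_bij)
      then show ?thesis by (simp add: m_def unit[OF x] flip: prod.distrib)
    qed
    then have "cube_avg (directions js) (m p) 0 = cube_avg (directions js) (\<lambda>_. 1) 0"
      by (intro cube_avg_cong)
    then show ?thesis by simp
  qed
  have nonperm_term: "cube_avg (directions js) (m p) 0 = 0" if "\<not> p permutes UNIV" for p
  proof -
    have "\<not> surj p" using that finite_UNIV_surj_inj[of p] bij_imp_permutes[of p UNIV] by (auto simp: bij_def)
    then obtain k where k: "k \<notin> range p" by auto
    define R where "R x = (\<chi> j. if j = k then - x $ j else x $ j)" for x :: "complex^'n"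
    have lin: "linear R" unfolding R_def by (auto simp: linear_iff vec_eq_iff)
    have R: "R v = v \<or> R v = - v" if "v \<in> set (directions js)" for v
      using that by (auto simp: set_directions R_def vec_eq_iff axis_def)
    have "m p (R x) = - m p x" for x
    proof -
      have "(\<Prod>j\<in>UNIV. cnj (R x $ j)) = cnj (R x $ k) * (\<Prod>j\<in>UNIV - {k}. cnj (R x $ j))"
        by (simp add: prod.remove)
      also have "\<dots> = - (cnj (x $ k) * (\<Prod>j\<in>UNIV - {k}. cnj (x $ j)))"
        by (simp add: R_def)
      also have "\<dots> = - (\<Prod>j\<in>UNIV. cnj (x $ j))" by (simp add: prod.remove[of UNIV k])
      finally have "(\<Prod>j\<in>UNIV. cnj (R x $ j)) = - (\<Prod>j\<in>UNIV. cnj (x $ j))" .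
      moreover have "R x $ p i = x $ p i" for i using k by (auto simp: R_def)
      ultimately show ?thesis by (simp add: m_def)
    qed
    then have "cube_avg (directions js) (m p) (R 0) = - cube_avg (directions js) (m p) 0"
      using cube_avg_reflect[OF lin R, of "directions js" "m p" 0] by (simp add: cube_avg_minus)
    then show ?thesis by (simp add: linear_0[OF lin])
  qed
  have "(\<lambda>x. (\<Prod>j\<in>UNIV. cnj (x $ j)) * (\<Prod>i\<in>UNIV. (A *v x) $ i))
      = (\<lambda>x. \<Sum>p\<in>UNIV. (\<Prod>i\<in>UNIV. A $ i $ p i) * m p x)"
  proof
    fix x :: "complex^'n"
    have "(\<Prod>i\<in>UNIV. (A *v x) $ i) = (\<Sum>p\<in>UNIV. \<Prod>i\<in>UNIV. A $ i $ p i * x $ p i)"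
      using prod_sum_PiE[of "UNIV :: 'n set" "\<lambda>_. UNIV :: 'n set" "\<lambda>i j. A $ i $ j * x $ j"]
      by (simp add: matrix_vector_mult_def PiE_UNIV_domain)
    then show "(\<Prod>j\<in>UNIV. cnj (x $ j)) * (\<Prod>i\<in>UNIV. (A *v x) $ i)
      = (\<Sum>p\<in>UNIV. (\<Prod>i\<in>UNIV. A $ i $ p i) * m p x)"
      by (simp add: m_def prod.distrib sum_distrib_left mult.left_commute)
  qed
  then have "cube_avg (directions js) (\<lambda>x. (\<Prod>j\<in>UNIV. cnj (x $ j)) * (\<Prod>i\<in>UNIV. (A *v x) $ i)) 0
      = (\<Sum>p\<in>UNIV. (\<Prod>i\<in>UNIV. A $ i $ p i) * cube_avg (directions js) (m p) 0)"
    by (simp add: cube_avg_sum cube_avg_mult_left)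
  also have "\<dots> = (\<Sum>p\<in>UNIV. if p permutes UNIV then \<Prod>i\<in>UNIV. A $ i $ p i else 0)"
    by (rule sum.cong) (auto simp: perm_term nonperm_term)
  also have "\<dots> = perm A" by (simp add: perm_def sum.If_cases)
  finally show ?thesis by simp
qed

subsection \<open>The first absolute moment of a linear form\<close>

text \<open>The average over \<open>e\<close> times a random fourth root of unity, which is the
  effect of one random coordinate up to a fixed rotation.\<close>

definition quad_avg :: "complex \<Rightarrow> (complex \<Rightarrow> real) \<Rightarrow> complex \<Rightarrow> real" where
  "quad_avg e f w = (f (w + e) + f (w - e) + f (w + \<i> * e) + f (w - \<i> * e)) / 4"

lemma quad_avg_power:
  fixes w e :: complex
  defines "P \<equiv> (cmod w)\<^sup>2" and "E \<equiv> (cmod e)\<^sup>2"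
  shows "quad_avg e (\<lambda>w. (cmod w)\<^sup>2) w = P + E"
    and "quad_avg e (\<lambda>w. ((cmod w)\<^sup>2)\<^sup>2) w = P\<^sup>2 + 4 * P * E + E\<^sup>2"
    and "quad_avg e (\<lambda>w. ((cmod w)\<^sup>2)^3) w = P^3 + 9 * P\<^sup>2 * E + 9 * P * E\<^sup>2 + E^3"
proof -
  \<comment> \<open>\<open>x\<close> and \<open>y\<close> are twice the real and imaginary parts of
    \<open>w * cnj e\<close>, so their squares sum to \<open>4 * P * E\<close>; odd powers cancel in
    the average.\<close>
  define x where "x = 2 * (Re w * Re e + Im w * Im e)"
  define y where "y = 2 * (Im w * Re e - Re w * Im e)"
  have n: "(cmod (w + e))\<^sup>2 = P + E + x" "(cmod (w - e))\<^sup>2 = P + E - x"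
    "(cmod (w + \<i> * e))\<^sup>2 = P + E + y" "(cmod (w - \<i> * e))\<^sup>2 = P + E - y"
    unfolding cmod_power2 x_def y_def P_def E_def by (simp_all add: power2_eq_square algebra_simps)
  have xy: "y\<^sup>2 = 4 * P * E - x\<^sup>2"
    unfolding cmod_power2 x_def y_def P_def E_def by (simp add: power2_eq_square algebra_simps)
  show "quad_avg e (\<lambda>w. (cmod w)\<^sup>2) w = P + E" unfolding quad_avg_def n by simp
  have "((P + E + x)\<^sup>2 + (P + E - x)\<^sup>2 + (P + E + y)\<^sup>2 + (P + E - y)\<^sup>2) / 4
      = (P + E)\<^sup>2 + (x\<^sup>2 + y\<^sup>2) / 2"
    by (simp add: power2_eq_square algebra_simps)
  then show "quad_avg e (\<lambda>w. ((cmod w)\<^sup>2)\<^sup>2) w = P\<^sup>2 + 4 * P * E + E\<^sup>2"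
    unfolding quad_avg_def n xy by (simp add: power2_eq_square algebra_simps)
  have "((P + E + x)^3 + (P + E - x)^3 + (P + E + y)^3 + (P + E - y)^3) / 4
      = (P + E)^3 + 3 * (P + E) * (x\<^sup>2 + y\<^sup>2) / 2"
    by (simp add: power2_eq_square power3_eq_cube algebra_simps)
  then show "quad_avg e (\<lambda>w. ((cmod w)\<^sup>2)^3) w = P^3 + 9 * P\<^sup>2 * E + 9 * P * E\<^sup>2 + E^3"
    unfolding quad_avg_def n xy by (simp add: power2_eq_square power3_eq_cube algebra_simps)
qed

text \<open>Bilinear, without conjugation, so that a row of \<open>A\<close> yields a coordinate of
  \<open>A *v x\<close>.\<close>

definition cdot :: "complex^'n \<Rightarrow> complex^'n \<Rightarrow> complex" where
  "cdot a x = (\<Sum>j\<in>UNIV. a $ j * x $ j)"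

text \<open>The four sign choices at \<open>j\<close> change the form by the multiples of a single
  \<open>e\<close> by fourth roots of unity. Only the modulus of \<open>e\<close> is recorded, as
  the even moments depend on nothing else.\<close>

lemma cube_avg_directions_Cons:
  fixes a :: "complex^'n" and f :: "complex \<Rightarrow> real"
  shows "\<exists>e. cmod e = cmod (a $ j) \<and>
    cube_avg (directions (j # js)) (\<lambda>x. f (cdot a x)) z = cube_avg (directions js) (\<lambda>x. quad_avg e f (cdot a x)) z"
proof -
  define r where "r = complex_of_real (1 / sqrt 2)"
  have S_axis: "cdot a (x + axis j c) = cdot a x + a $ j * c" "cdot a (x - axis j c) = cdot a x - a $ j * c" for x c
    by (simp_all add: cdot_def axis_def distrib_left right_diff_distrib sum.distrib sum_subtractf
        if_distrib[of "(*) _"] cong: if_cong)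
  define e where "e = a $ j * (r + \<i> * r)"
  have "cmod (r + \<i> * r) = 1" using cmod_sqrt2_combination[of 1 1] by (simp add: r_def)
  then have "cmod e = cmod (a $ j)" by (simp add: e_def norm_mult)
  moreover have "cube_avg (directions (j # js)) (\<lambda>x. f (cdot a x)) z = cube_avg (directions js) (\<lambda>x. quad_avg e f (cdot a x)) z"
  proof -
    have ie: "\<i> * e = a $ j * (\<i> * r) - a $ j * r" by (simp add: e_def algebra_simps)
    show ?thesis
      unfolding directions_simps cube_avg_Cons_inner r_def[symmetric] S_axis quad_avg_def ie
      by (simp add: e_def diff_divide_distrib add_divide_distrib algebra_simps)
  qed
  ultimately show ?thesis by blast
qed

text \<open>Averaging out one coordinate expresses each moment through itself and the lower ones, so
  all three share one induction.\<close>

lemma cube_avg_moments: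
  fixes a :: "complex^'n"
  defines "s \<equiv> \<lambda>k js. \<Sum>j\<leftarrow>js. ((cmod (a $ j))\<^sup>2) ^ k"
  shows "cube_avg (directions js) (\<lambda>x. (cmod (cdot a x))\<^sup>2) 0 = s 1 js"
    and "cube_avg (directions js) (\<lambda>x. ((cmod (cdot a x))\<^sup>2)\<^sup>2) 0 = 2 * (s 1 js)\<^sup>2 - s 2 js"
    and "cube_avg (directions js) (\<lambda>x. ((cmod (cdot a x))\<^sup>2)^3) 0
      = 6 * (s 1 js)^3 - 9 * s 1 js * s 2 js + 4 * s 3 js"
proof (induction js)
  case Nil
  show "cube_avg (directions []) (\<lambda>x. (cmod (cdot a x))\<^sup>2) 0 = s 1 []"
    and "cube_avg (directions []) (\<lambda>x. ((cmod (cdot a x))\<^sup>2)\<^sup>2) 0 = 2 * (s 1 [])\<^sup>2 - s 2 []"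
    and "cube_avg (directions []) (\<lambda>x. ((cmod (cdot a x))\<^sup>2)^3) 0
      = 6 * (s 1 [])^3 - 9 * s 1 [] * s 2 [] + 4 * s 3 []"
    by (simp_all add: cdot_def s_def)
next
  case (Cons j js)
  note step = cube_avg_directions_Cons[of a j js _ 0]
  have s: "s k (j # js) = ((cmod (a $ j))\<^sup>2) ^ k + s k js" for k by (simp add: s_def)
  note avg_simps = quad_avg_power cube_avg_add cube_avg_mult_left Cons.IH s
  obtain e where e: "cmod e = cmod (a $ j)" and eq: "cube_avg (directions (j # js)) (\<lambda>x. (cmod (cdot a x))\<^sup>2) 0
    = cube_avg (directions js) (\<lambda>x. quad_avg e (\<lambda>w. (cmod w)\<^sup>2) (cdot a x)) 0"
    using step[of "\<lambda>w. (cmod w)\<^sup>2"] by blast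
  show "cube_avg (directions (j # js)) (\<lambda>x. (cmod (cdot a x))\<^sup>2) 0 = s 1 (j # js)"
    unfolding eq avg_simps e by simp
  obtain e where e: "cmod e = cmod (a $ j)" and eq: "cube_avg (directions (j # js)) (\<lambda>x. ((cmod (cdot a x))\<^sup>2)\<^sup>2) 0
    = cube_avg (directions js) (\<lambda>x. quad_avg e (\<lambda>w. ((cmod w)\<^sup>2)\<^sup>2) (cdot a x)) 0"
    using step[of "\<lambda>w. ((cmod w)\<^sup>2)\<^sup>2"] by blast
  define E where "E = (cmod (a $ j))\<^sup>2"
  have "cube_avg (directions (j # js)) (\<lambda>x. ((cmod (cdot a x))\<^sup>2)\<^sup>2) 0
      = cube_avg (directions js) (\<lambda>x. ((cmod (cdot a x))\<^sup>2)\<^sup>2 + (4 * E) * (cmod (cdot a x))\<^sup>2 + E\<^sup>2) 0"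
    unfolding eq quad_avg_power e E_def by (simp add: algebra_simps)
  then show "cube_avg (directions (j # js)) (\<lambda>x. ((cmod (cdot a x))\<^sup>2)\<^sup>2) 0
      = 2 * (s 1 (j # js))\<^sup>2 - s 2 (j # js)"
    unfolding avg_simps by (simp flip: E_def) (simp add: power2_eq_square algebra_simps)
  obtain e where e: "cmod e = cmod (a $ j)" and eq: "cube_avg (directions (j # js)) (\<lambda>x. ((cmod (cdot a x))\<^sup>2)^3) 0
    = cube_avg (directions js) (\<lambda>x. quad_avg e (\<lambda>w. ((cmod w)\<^sup>2)^3) (cdot a x)) 0"
    using step[of "\<lambda>w. ((cmod w)\<^sup>2)^3"] by blast
  have "cube_avg (directions (j # js)) (\<lambda>x. ((cmod (cdot a x))\<^sup>2)^3) 0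
      = cube_avg (directions js) (\<lambda>x. ((cmod (cdot a x))\<^sup>2)^3 + (9 * E) * ((cmod (cdot a x))\<^sup>2)\<^sup>2
          + (9 * E\<^sup>2) * (cmod (cdot a x))\<^sup>2 + E^3) 0"
    unfolding eq quad_avg_power e E_def by (simp add: algebra_simps)
  then show "cube_avg (directions (j # js)) (\<lambda>x. ((cmod (cdot a x))\<^sup>2)^3) 0
      = 6 * (s 1 (j # js))^3 - 9 * s 1 (j # js) * s 2 (j # js) + 4 * s 3 (j # js)"
    unfolding avg_simps by (simp flip: E_def) (simp add: power2_eq_square power3_eq_cube algebra_simps)
qed

text \<open>The cubic in \<open>r\<^sup>2\<close> touches the graph of \<open>r\<close> at \<open>1\<close> and \<open>3/2\<close>. Writing \<open>Y = \<bar>\<langle>a, X\<rangle>\<bar>\<^sup>2 - 1\<close>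
  with \<open>\<parallel>a\<parallel> = 1\<close>, the moments satisfy \<open>E[Y\<^sup>3] \<le> 2 E[Y\<^sup>2]\<close>, so what matters is that
  \<open>8/75 - 2 \<cdot> 8/375 = 8/125\<close> is large enough.\<close>

lemma cubic_upper_bound:
  fixes r :: real
  assumes "r \<ge> 0"
  shows "r \<le> 1 + (r\<^sup>2 - 1) / 2 - 8/75 * (r\<^sup>2 - 1)\<^sup>2 + 8/375 * (r\<^sup>2 - 1)^3"
proof -
  have "1 + (r\<^sup>2 - 1) / 2 - 8/75 * (r\<^sup>2 - 1)\<^sup>2 + 8/375 * (r\<^sup>2 - 1)^3 - r
      = 8/375 * (r - 1)\<^sup>2 * (r - 3/2)\<^sup>2 * (r\<^sup>2 + 5 * r + 31/4)"
    by (simp add: power2_eq_square power3_eq_cube) algebra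
  moreover have "\<dots> \<ge> 0" using assms by simp
  ultimately show ?thesis by linarith
qed

section \<open>Vector norms and the first moment estimate\<close>

lemma norm_vec_squared: "(norm (a :: complex^'n))\<^sup>2 = (\<Sum>j\<in>UNIV. (cmod (a $ j))\<^sup>2)"
  by (simp add: norm_vec_def L2_set_def sum_nonneg)

lemma cmod_nth_le_linf_norm: "cmod (a $ j) \<le> linf_norm a"
  by (simp add: linf_norm_def)

lemma linf_norm_nonneg: "0 \<le> linf_norm a"
  using cmod_nth_le_linf_norm norm_ge_zero order_trans by blast

lemma linf_norm_le_norm: "linf_norm a \<le> norm a"
  by (auto simp: linf_norm_def Finite_Cartesian_Product.norm_nth_le)

lemma linf_norm_scaleR: "linf_norm (c *\<^sub>R a) = \<bar>c\<bar> * linf_norm a"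
proof -
  have "range (\<lambda>j. cmod ((c *\<^sub>R a) $ j)) = (*) \<bar>c\<bar> ` range (\<lambda>j. cmod (a $ j))" by auto
  moreover have "mono ((*) \<bar>c\<bar>)" by (auto simp: mono_def mult_left_mono)
  ultimately show ?thesis by (simp add: linf_norm_def mono_Max_commute)
qed

text \<open>Averaging the cubic bound leaves an expression in \<open>s 2\<close> and
  \<open>s 3\<close>; \<open>s 3 \<le> s 2\<close> removes the latter, and
  \<open>s 2 \<le> linf_norm a\<close> turns the remaining gain \<open>8/125 * (1 - s 2)\<close>
  into the stated one.\<close>

lemma cube_avg_cmod_cdot_unit:
  fixes a :: "complex^'n"
  assumes js: "distinct js" "set js = (UNIV :: 'n set)" and a: "norm a = 1"
  shows "cube_avg (directions js) (\<lambda>x. cmod (cdot a x)) 0 \<le> 1 - 8/125 * (1 - linf_norm a)"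
proof -
  define s where "s k = (\<Sum>j\<in>UNIV. ((cmod (a $ j))\<^sup>2) ^ k)" for k
  have s_list: "(\<Sum>j\<leftarrow>js. ((cmod (a $ j))\<^sup>2) ^ k) = s k" for k
    using js by (simp add: s_def sum_list_distinct_conv_sum_set)
  have s1: "s 1 = 1" using norm_vec_squared[of a] a by (simp add: s_def)
  have entry: "(cmod (a $ j))\<^sup>2 \<le> 1" for j using Finite_Cartesian_Product.norm_nth_le[of a j] a by (simp add: power_le_one)
  have s32: "s 3 \<le> s 2" unfolding s_def using entry by (intro sum_mono power_decreasing) auto
  have s2: "s 2 \<le> linf_norm a"
  proof -
    have "(cmod (a $ j))\<^sup>2 \<le> linf_norm a" for j
    proof -
      have "(cmod (a $ j))\<^sup>2 \<le> cmod (a $ j)"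
        using Finite_Cartesian_Product.norm_nth_le[of a j] a by (simp add: power2_eq_square mult_left_le)
      then show ?thesis using cmod_nth_le_linf_norm[of a j] by linarith
    qed
    then have "s 2 \<le> (\<Sum>j\<in>UNIV. linf_norm a * (cmod (a $ j))\<^sup>2)"
      unfolding s_def power2_eq_square[of "(cmod _)\<^sup>2"] by (intro sum_mono mult_right_mono) auto
    also have "\<dots> = linf_norm a" using s1 by (simp add: s_def flip: sum_distrib_left)
    finally show ?thesis .
  qed
  let ?E = "\<lambda>f. cube_avg (directions js) f 0"
  let ?u = "\<lambda>x. (cmod (cdot a x))\<^sup>2"
  have moments: "?E ?u = 1" "?E (\<lambda>x. (?u x)\<^sup>2) = 2 - s 2" "?E (\<lambda>x. (?u x)^3) = 6 - 9 * s 2 + 4 * s 3"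
    using cube_avg_moments[of js a] by (simp_all only: s_list s1) simp_all
  \<comment> \<open>The cubic is expanded in powers of \<open>?u\<close>, so that linearity reduces
    it to the known moments.\<close>
  have "?E (\<lambda>x. cmod (cdot a x))
      \<le> ?E (\<lambda>x. (1 / 2 - 8/75 - 8/375) + ((1/2 + 16/75 + 24/375) * ?u x
            + ((- 8/75 - 24/375) * (?u x)\<^sup>2 + 8/375 * (?u x)^3)))"
  proof (rule cube_avg_mono)
    fix x
    show "cmod (cdot a x) \<le> (1 / 2 - 8/75 - 8/375) + ((1/2 + 16/75 + 24/375) * ?u x
            + ((- 8/75 - 24/375) * (?u x)\<^sup>2 + 8/375 * (?u x)^3))"
      using cubic_upper_bound[of "cmod (cdot a x)"]
      by (simp add: power2_eq_square power3_eq_cube diff_divide_distrib algebra_simps)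
  qed
  also have "\<dots> = (1 / 2 - 8/75 - 8/375) + ((1/2 + 16/75 + 24/375) * 1
            + ((- 8/75 - 24/375) * (2 - s 2) + 8/375 * (6 - 9 * s 2 + 4 * s 3)))"
    by (simp only: cube_avg_add cube_avg_mult_left cube_avg_const moments)
  also have "\<dots> \<le> 1 - 8/125 * (1 - linf_norm a)" using s32 s2 by argo
  finally show ?thesis .
qed

lemma cube_avg_cmod_cdot:
  fixes a :: "complex^'n"
  assumes js: "distinct js" "set js = (UNIV :: 'n set)"
  shows "cube_avg (directions js) (\<lambda>x. cmod (cdot a x)) 0 \<le> norm a - 8/125 * (norm a - linf_norm a)"
proof (cases "a = 0")
  case True
  then show ?thesis using linf_norm_nonneg[of "0 :: complex^'n"] by (simp add: cdot_def)
next
  case False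
  define b where "b = a /\<^sub>R norm a"
  have b: "norm b = 1" and a: "a = norm a *\<^sub>R b" using False by (simp_all add: b_def)
  have cdot: "cmod (cdot a x) = norm a * cmod (cdot b x)" for x
  proof -
    have "cdot a x = norm a *\<^sub>R cdot b x"
      by (subst a) (simp add: cdot_def scaleR_sum_right)
    then show ?thesis by simp
  qed
  have linf: "linf_norm a = norm a * linf_norm b" using linf_norm_scaleR[of "norm a" b] a by simp
  have "norm a * cube_avg (directions js) (\<lambda>x. cmod (cdot b x)) 0
      \<le> norm a * (1 - 8/125 * (1 - linf_norm b))"
    by (intro mult_left_mono cube_avg_cmod_cdot_unit js b) simp
  then show ?thesis unfolding cdot cube_avg_mult_left linf by (simp add: algebra_simps)
qed

subsection \<open>The bound on the permanent\<close>

lemma matrix_vector_cdot: "(A *v x) $ i = cdot (row i A) x"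
  by (simp add: matrix_vector_mult_def cdot_def row_def)

lemma bounded_linear_matrix_vector: "bounded_linear ((*v) (A :: complex^'n^'n))"
proof -
  have "linear ((*v) A)"
    by (rule linearI) (simp_all add: matrix_vector_right_distrib vec_eq_iff
        matrix_vector_mult_def scaleR_sum_right distrib_left sum.distrib)
  then show ?thesis by (rule linear_conv_bounded_linear[THEN iffD1])
qed

lemma norm_row_le_onorm: "norm (row i A) \<le> onorm ((*v) (A :: complex^'n^'n))"
proof (cases "row i A = 0")
  case True
  then show ?thesis using onorm_pos_le[OF bounded_linear_matrix_vector] by simp
next
  case False
  define r where "r = row i A"
  \<comment> \<open>Tested on the conjugated row, coordinate \<open>i\<close> of the image is the
    squared norm of the row.\<close>
  define x where "x = (\<chi> j. cnj (r $ j))"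
  have nx: "norm x = norm r" by (simp add: x_def norm_vec_def)
  have "(A *v x) $ i = of_real ((norm r)\<^sup>2)"
    unfolding matrix_vector_cdot r_def[symmetric] norm_vec_squared
    by (simp add: cdot_def x_def flip: complex_norm_square)
  then have "(norm r)\<^sup>2 \<le> norm (A *v x)"
    using Finite_Cartesian_Product.norm_nth_le[of "A *v x" i] by (simp add: norm_power)
  also have "\<dots> \<le> onorm ((*v) A) * norm r"
    using onorm[OF bounded_linear_matrix_vector, of A x] by (simp add: nx)
  finally show ?thesis using False by (simp add: r_def power2_eq_square)
qed

text \<open>Cauchy--Schwarz against the all-ones vector.\<close>

lemma mean_cmod_le:
  fixes y :: "complex^'n"
  shows "(\<Sum>i\<in>UNIV. cmod (y $ i)) / real CARD('n) \<le> norm y / sqrt (real CARD('n))"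
proof -
  have "(\<Sum>i\<in>UNIV. cmod (y $ i)) \<le> sqrt (real CARD('n)) * norm y"
    using L2_set_mult_ineq[of "\<lambda>_. 1" "\<lambda>i. cmod (y $ i)" "UNIV :: 'n set"]
    by (simp add: norm_vec_def L2_set_def)
  then have "(\<Sum>i\<in>UNIV. cmod (y $ i)) / real CARD('n) \<le> sqrt (real CARD('n)) * norm y / real CARD('n)"
    by (rule divide_right_mono) simp
  also have "\<dots> = norm y / (real CARD('n) / sqrt (real CARD('n)))" by simp
  finally show ?thesis by (simp only: real_div_sqrt of_nat_0_le_iff)
qed

text \<open>Isolates the concentration argument: what then remains is to bound the average of
  \<open>F\<close> away from 1.\<close>

lemma perm_bound_by_mean:
  fixes A :: "complex^'n^'n" and T :: real
  assumes T: "T > 0" and A: "onorm ((*v) A) \<le> T"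
    and js: "distinct js" "set js = (UNIV :: 'n set)"
  defines "F \<equiv> \<lambda>x. (\<Sum>i\<in>UNIV. cmod ((A *v x) $ i)) / real CARD('n) / T"
  defines "\<delta> \<equiv> 1 - cube_avg (directions js) F 0"
  assumes \<delta>: "\<delta> \<ge> 0"
  shows "cmod (perm A) \<le> T ^ CARD('n) * exp (- (real CARD('n) * \<delta>\<^sup>2 / 8))"
proof -
  define n where "n = real CARD('n)"
  have n: "n > 0" by (simp add: n_def)
  have op: "norm (A *v x) \<le> T * norm x" for x
    using onorm[OF bounded_linear_matrix_vector, of A x] mult_right_mono[OF A, of "norm x"] by simp
  \<comment> \<open>Division by \<open>T\<close> cancels the operator norm, and
    \<open>mean_cmod_le\<close> supplies \<open>1 / sqrt n\<close>.\<close>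
  have Lip: "F x \<le> F y + norm (x - y) / sqrt n" for x y
  proof -
    have "(\<Sum>i\<in>UNIV. cmod ((A *v x) $ i)) - (\<Sum>i\<in>UNIV. cmod ((A *v y) $ i))
        \<le> (\<Sum>i\<in>UNIV. cmod ((A *v (x - y)) $ i))"
      unfolding sum_subtractf[symmetric]
      by (intro sum_mono) (simp add: matrix_vector_mult_diff_distrib norm_triangle_ineq2)
    then have "F x - F y \<le> (\<Sum>i\<in>UNIV. cmod ((A *v (x - y)) $ i)) / n / T"
      unfolding F_def n_def[symmetric] diff_divide_distrib[symmetric]
      using n T by (intro divide_right_mono) auto
    also have "\<dots> \<le> norm (A *v (x - y)) / sqrt n / T"
      unfolding n_def using T by (intro divide_right_mono mean_cmod_le) auto
    also have "\<dots> \<le> (T * norm (x - y)) / sqrt n / T"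
      using T n by (intro divide_right_mono op) auto
    finally show ?thesis using T by simp
  qed
  have F_nonneg: "F x \<ge> 0" for x unfolding F_def using T by (simp add: sum_nonneg)
  have F0: "F 0 = 0" by (simp add: F_def)
  have norm_corner: "norm x = sqrt n" if "x \<in> corners (directions js) 0" for x
  proof -
    have "cmod (x $ j) = 1" for j using corners_directions[OF js(1) that] js(2) by simp
    then have "(norm x)\<^sup>2 = n" by (simp add: norm_vec_squared n_def)
    then show ?thesis by (metis norm_ge_zero real_sqrt_unique)
  qed
  have F_le_1: "F x \<le> 1" if "x \<in> corners (directions js) 0" for x
    using Lip[of x 0] norm_corner[OF that] F0 n by simp
  have convF: "convex_on UNIV F"
  proof (rule convex_onI)
    fix t and x y :: "complex^'n" assume t: "0 < t" "t < (1::real)"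
    have "cmod ((A *v ((1 - t) *\<^sub>R x + t *\<^sub>R y)) $ i)
        \<le> (1 - t) * cmod ((A *v x) $ i) + t * cmod ((A *v y) $ i)" for i
    proof -
      have "A *v ((1 - t) *\<^sub>R x + t *\<^sub>R y) = (1 - t) *\<^sub>R (A *v x) + t *\<^sub>R (A *v y)"
        using bounded_linear.linear[OF bounded_linear_matrix_vector, of A]
        by (simp only: linear_add linear_cmul)
      then show ?thesis
        using t norm_triangle_ineq[of "(1 - t) *\<^sub>R (A *v x) $ i" "t *\<^sub>R (A *v y) $ i"] by simp
    qed
    then have "(\<Sum>i\<in>UNIV. cmod ((A *v ((1 - t) *\<^sub>R x + t *\<^sub>R y)) $ i))
        \<le> (1 - t) * (\<Sum>i\<in>UNIV. cmod ((A *v x) $ i)) + t * (\<Sum>i\<in>UNIV. cmod ((A *v y) $ i))"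
      unfolding sum_distrib_left sum.distrib[symmetric] by (rule sum_mono)
    then have "F ((1 - t) *\<^sub>R x + t *\<^sub>R y) \<le> ((1 - t) * (\<Sum>i\<in>UNIV. cmod ((A *v x) $ i))
        + t * (\<Sum>i\<in>UNIV. cmod ((A *v y) $ i))) / n / T"
      unfolding F_def n_def[symmetric] using n T by (intro divide_right_mono) auto
    then show "F ((1 - t) *\<^sub>R x + t *\<^sub>R y) \<le> (1 - t) * F x + t * F y"
      by (simp add: F_def n_def add_divide_distrib)
  qed simp
  let ?E = "\<lambda>f. cube_avg (directions js) f 0"
  have "?E F \<ge> ?E (\<lambda>_. 0)" using F_nonneg by (intro cube_avg_mono)
  then have \<delta>1: "\<delta> \<le> 1" by (simp add: \<delta>_def)
  \<comment> \<open>This minimises \<open>- (s * \<delta>) + 2 * s\<^sup>2 / n\<close>, the exponent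
    reached at the end.\<close>
  define s where "s = n * \<delta> / 4"
  have s: "0 \<le> s" "s \<le> n" using \<delta> \<delta>1 n mult_left_mono[OF \<delta>1, of n] by (simp_all add: s_def)
  \<comment> \<open>With \<open>c = 1/8\<close> the length condition is an equality, as the steps
    have squared norm 1/2. The subtracted \<open>2 * s\<^sup>2 / n\<close> pays for completing the
    square in the Lipschitz bound.\<close>
  have Maurey: "?E (\<lambda>x. exp (s * F x - 2 * s\<^sup>2 / n)) * ?E (\<lambda>x. exp (- (s * F x))) \<le> 1"
  proof (rule cube_infconv_inequality)
    show "convex_on UNIV (\<lambda>x. s * F x)" using s convF by (intro convex_on_cmul)
    show "0 \<le> s * F x" for x using s F_nonneg by simp
    show "(0::real) \<le> 1/8" by simp
    show "sorted_wrt (\<lambda>v w. v \<bullet> w = 0) (directions js)" by (rule directions_orthogonal[OF js(1)])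
    show "16 * (1/8) * (norm v)\<^sup>2 \<le> 1" if "v \<in> set (directions js)" for v
      using norm_directions[OF that] by simp
    show "s * F x - 2 * s\<^sup>2 / n \<le> s * F (x + y) + 1/8 * (norm y)\<^sup>2" for x y
    proof -
      have "s * F x \<le> s * (F (x + y) + norm y / sqrt n)"
        using Lip[of x "x + y"] s by (intro mult_left_mono) auto
      moreover have "s * norm y / sqrt n \<le> 1/8 * (norm y)\<^sup>2 + 2 * s\<^sup>2 / n"
      proof -
        have "0 \<le> (norm y - 4 * s / sqrt n)\<^sup>2 / 8" by simp
        also have "\<dots> = 1/8 * (norm y)\<^sup>2 + 2 * s\<^sup>2 / n - s * norm y / sqrt n"
          using n by (simp add: power2_diff power_divide power_mult_distrib field_simps)
        finally show ?thesis by simp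
      qed
      ultimately show ?thesis by (simp add: distrib_left)
    qed
  qed
  \<comment> \<open>Jensen bounds the second factor from below, which leaves an upper bound on the
    exponential moment of \<open>F\<close>.\<close>
  have "exp (- (s * ?E F)) \<le> ?E (\<lambda>x. exp (- (s * F x)))"
    using cube_avg_exp_Jensen[of "directions js" "\<lambda>x. - (s * F x)" 0]
    by (simp add: cube_avg_minus cube_avg_mult_left)
  then have "?E (\<lambda>x. exp (s * F x - 2 * s\<^sup>2 / n)) * exp (- (s * ?E F))
      \<le> ?E (\<lambda>x. exp (s * F x - 2 * s\<^sup>2 / n)) * ?E (\<lambda>x. exp (- (s * F x)))"
    by (intro mult_left_mono less_imp_le[OF cube_avg_exp_pos])
  also note Maurey
  also have "?E (\<lambda>x. exp (s * F x - 2 * s\<^sup>2 / n)) = exp (- (2 * s\<^sup>2 / n)) * ?E (\<lambda>x. exp (s * F x))"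
    by (simp flip: cube_avg_mult_left exp_add)
  finally have "exp (- (2 * s\<^sup>2 / n)) * ?E (\<lambda>x. exp (s * F x)) * exp (- (s * ?E F)) \<le> 1" .
  then have mgf: "?E (\<lambda>x. exp (s * F x)) \<le> exp (s * ?E F + 2 * s\<^sup>2 / n)"
    unfolding exp_add by (simp add: exp_minus divide_simps mult_ac)
  have pointwise: "norm ((\<Prod>j\<in>UNIV. cnj (x $ j)) * (\<Prod>i\<in>UNIV. (A *v x) $ i))
      \<le> T ^ CARD('n) * exp (- s) * exp (s * F x)" if x: "x \<in> corners (directions js) 0" for x
  proof -
    have "cmod (x $ j) = 1" for j using corners_directions[OF js(1) x] js(2) by simp
    then have "norm ((\<Prod>j\<in>UNIV. cnj (x $ j)) * (\<Prod>i\<in>UNIV. (A *v x) $ i))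
        = (\<Prod>i\<in>UNIV. cmod ((A *v x) $ i))"
      by (simp add: norm_mult flip: prod_norm)
    also have "\<dots> \<le> (\<Prod>i\<in>UNIV. T * exp (cmod ((A *v x) $ i) / T - 1))"
    proof (rule prod_mono)
      fix i
      have "cmod ((A *v x) $ i) / T \<le> exp (cmod ((A *v x) $ i) / T - 1)"
        using exp_ge_add_one_self[of "cmod ((A *v x) $ i) / T - 1"] by simp
      then show "0 \<le> cmod ((A *v x) $ i) \<and> cmod ((A *v x) $ i) \<le> T * exp (cmod ((A *v x) $ i) / T - 1)"
        using T by (simp add: pos_divide_le_eq mult.commute)
    qed
    also have "\<dots> = T ^ CARD('n) * exp (n * (F x - 1))"
    proof -
      have "(\<Sum>i\<in>UNIV. cmod ((A *v x) $ i) / T - 1) = n * (F x - 1)"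
        using n by (simp add: sum_subtractf F_def n_def[symmetric] algebra_simps flip: sum_divide_distrib)
      then show ?thesis by (simp add: prod.distrib flip: exp_sum)
    qed
    \<comment> \<open>\<open>F x - 1\<close> is nonpositive at corners, so lowering the factor
      \<open>n\<close> to \<open>s\<close> cannot decrease the exponent.\<close>
    also have "\<dots> \<le> T ^ CARD('n) * exp (s * (F x - 1))"
      using T s F_le_1[OF x] by (intro mult_left_mono) (auto intro: mult_right_mono_neg)
    finally show ?thesis by (simp add: right_diff_distrib exp_diff exp_minus field_simps)
  qed
  have "cmod (perm A) \<le> ?E (\<lambda>x. norm ((\<Prod>j\<in>UNIV. cnj (x $ j)) * (\<Prod>i\<in>UNIV. (A *v x) $ i)))"
    unfolding perm_eq_cube_avg[OF js] by (rule norm_cube_avg_le)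
  also have "\<dots> \<le> ?E (\<lambda>x. T ^ CARD('n) * exp (- s) * exp (s * F x))"
    by (rule cube_avg_mono) (rule pointwise)
  also have "\<dots> \<le> T ^ CARD('n) * exp (- s) * exp (s * ?E F + 2 * s\<^sup>2 / n)"
    unfolding cube_avg_mult_left using T by (intro mult_left_mono mgf) auto
  also have "\<dots> = T ^ CARD('n) * exp (- (n * \<delta>\<^sup>2 / 8))"
  proof -
    have "- s + (s * ?E F + 2 * s\<^sup>2 / n) = - (s * \<delta>) + 2 * s\<^sup>2 / n" by (simp add: \<delta>_def algebra_simps)
    also have "\<dots> = - (n * \<delta>\<^sup>2 / 8)"
      using n by (simp add: s_def power2_eq_square field_simps)
    finally show ?thesis by (simp add: mult.assoc flip: exp_add)
  qed
  finally show ?thesis unfolding n_def .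
qed

theorem theorem2:
  fixes A :: "complex^'n^'n" and T :: real
  assumes "T > 0" and "onorm ((*v) A) \<le> T"
  shows "cmod (perm A) \<le> 2 * T ^ CARD('n) *
           exp (- (3 * real CARD('n) *
             (1 - sqrt pi / 2 * (h2 A / T) - (1 - sqrt pi / 2) * (hinf A / T))\<^sup>2 / 100))
       \<and> cmod (perm A) \<le> 2 * T ^ CARD('n) *
           exp (- (real CARD('n) * (1 - hinf A / T)\<^sup>2 / 10 ^ 5))"
proof -
  obtain js :: "'n list" where js: "distinct js" "set js = UNIV"
    using ex_enumeration by blast
  define n where "n = real CARD('n)"
  have n: "n > 0" by (simp add: n_def)
  define H where "H = h2 A / T"
  define M where "M = hinf A / T"
  define \<mu> where "\<mu> = cube_avg (directions js) (\<lambda>x. (\<Sum>i\<in>UNIV. cmod ((A *v x) $ i)) / n / T) 0"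
  have M: "M \<le> H"
    unfolding M_def H_def hinf_def h2_def using assms(1)
    by (intro divide_right_mono sum_mono linf_norm_le_norm) auto
  have H: "H \<le> 1"
  proof -
    have "(\<Sum>i\<in>UNIV. norm (row i A)) \<le> (\<Sum>i\<in>(UNIV::'n set). T)"
      using norm_row_le_onorm[of _ A] assms(2) by (intro sum_mono) (meson order_trans)
    then have "h2 A \<le> T" using n by (simp add: h2_def n_def divide_simps mult.commute)
    then show ?thesis using assms(1) by (simp add: H_def)
  qed
  have \<mu>: "\<mu> \<le> H - 8/125 * (H - M)"
  proof -
    have "\<mu> = (\<Sum>i\<in>UNIV. cube_avg (directions js) (\<lambda>x. cmod (cdot (row i A) x)) 0) / n / T"
      unfolding \<mu>_def matrix_vector_cdot
      using cube_avg_mult_left[of "directions js" "1 / (n * T)" "\<lambda>x. \<Sum>i\<in>UNIV. cmod (cdot (row i A) x)" 0]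
      by (simp add: cube_avg_sum)
    also have "\<dots> \<le> (\<Sum>i\<in>UNIV. norm (row i A) - 8/125 * (norm (row i A) - linf_norm (row i A))) / n / T"
      using n assms(1) by (intro divide_right_mono sum_mono cube_avg_cmod_cdot js) auto
    also have "\<dots> = H - 8/125 * (H - M)"
      unfolding H_def M_def h2_def hinf_def n_def
      unfolding sum_subtractf sum_distrib_left[symmetric]
      by (simp add: diff_divide_distrib add_divide_distrib mult_ac)
    finally show ?thesis .
  qed
  define \<gamma> where "\<gamma> = sqrt pi / 2"
  define \<Delta> where "\<Delta> = 1 - \<gamma> * H - (1 - \<gamma>) * M"
  \<comment> \<open>The lower bound makes \<open>1 - \<gamma>\<close> at most \<open>16/125\<close>,
    twice the constant of the moment estimate; the upper one makes it at least \<open>1/10\<close>,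
    as (ii) requires.\<close>
  have \<gamma>: "109/125 \<le> \<gamma>" "\<gamma> \<le> 9/10"
  proof -
    have "pi \<ge> 3.1" "pi \<le> 3.2" using pi_approx by simp_all
    then have "(218/125)\<^sup>2 \<le> pi" "pi \<le> (9/5)\<^sup>2" by (simp_all add: power2_eq_square)
    then have "218/125 \<le> sqrt pi" "sqrt pi \<le> 9/5"
      by (simp_all only: real_le_rsqrt real_le_lsqrt)
    then show "109/125 \<le> \<gamma>" "\<gamma> \<le> 9/10" by (simp_all add: \<gamma>_def)
  qed
  have \<Delta>_eq: "\<Delta> = (1 - H) + (1 - \<gamma>) * (H - M)" by (simp add: \<Delta>_def algebra_simps)
  have "(1 - \<gamma>) * (H - M) \<le> 16/125 * (H - M)" "(1 - \<gamma>) * (H - M) \<ge> 1/10 * (H - M)"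
    using \<gamma> M by (intro mult_right_mono; simp)+
  note lower = this \<mu> H M
  \<comment> \<open>\<open>1 - \<mu>\<close> is at least \<open>(1 - H) + 8/125 * (H - M)\<close>;
    doubling this dominates both terms of \<open>\<Delta>\<close>, since
    \<open>H \<le> 1\<close>.\<close>
  have half: "\<Delta> / 2 \<le> 1 - \<mu>" unfolding \<Delta>_eq using lower by argo
  \<comment> \<open>\<open>1 - M\<close> splits into \<open>1 - H\<close> and \<open>H - M\<close>,
    and each has weight at least \<open>1/10\<close> in \<open>\<Delta>\<close>.\<close>
  have \<Delta>M: "(1 - M) / 10 \<le> \<Delta>" unfolding \<Delta>_eq using lower by argo
  have M1: "0 \<le> 1 - M" using H M by simp
  with \<Delta>M have \<Delta>: "\<Delta> \<ge> 0" by simp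
  have "cmod (perm A) \<le> T ^ CARD('n) * exp (- (n * (1 - \<mu>)\<^sup>2 / 8))"
    unfolding n_def using half \<Delta> perm_bound_by_mean[OF assms js] unfolding \<mu>_def n_def by simp
  also have "\<dots> \<le> T ^ CARD('n) * exp (- (3 * n * \<Delta>\<^sup>2 / 100))"
  proof -
    have "(\<Delta> / 2)\<^sup>2 \<le> (1 - \<mu>)\<^sup>2" using half \<Delta> by (intro power_mono) auto
    then have "\<Delta>\<^sup>2 / 4 \<le> (1 - \<mu>)\<^sup>2" by (simp add: power_divide)
    then have "3 * \<Delta>\<^sup>2 / 100 \<le> (1 - \<mu>)\<^sup>2 / 8" using zero_le_power2[of \<Delta>] by linarith
    then have "n * (3 * \<Delta>\<^sup>2 / 100) \<le> n * ((1 - \<mu>)\<^sup>2 / 8)" using n by (intro mult_left_mono) auto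
    then show ?thesis using assms(1) by (simp add: mult.left_commute)
  qed
  finally have bound: "cmod (perm A) \<le> T ^ CARD('n) * exp (- (3 * n * \<Delta>\<^sup>2 / 100))" .
  have double: "T ^ CARD('n) * exp r \<le> 2 * T ^ CARD('n) * exp r" for r
    using assms(1) by simp
  \<comment> \<open>The exponent of (i) implies that of (ii): bounding \<open>\<Delta>\<close> below
    by \<open>(1 - M) / 10\<close> gives the constant \<open>3 / 10 ^ 4\<close>.\<close>
  have "T ^ CARD('n) * exp (- (3 * n * \<Delta>\<^sup>2 / 100)) \<le> T ^ CARD('n) * exp (- (n * (1 - M)\<^sup>2 / 10 ^ 5))"
  proof -
    have "((1 - M) / 10)\<^sup>2 \<le> \<Delta>\<^sup>2" using \<Delta>M M1 by (intro power_mono) auto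
    then have "(1 - M)\<^sup>2 / 100 \<le> \<Delta>\<^sup>2" by (simp add: power_divide)
    then have "(1 - M)\<^sup>2 / 100000 \<le> 3 * \<Delta>\<^sup>2 / 100" using zero_le_power2[of "1 - M"] by linarith
    then have "(1 - M)\<^sup>2 / 10 ^ 5 \<le> 3 * \<Delta>\<^sup>2 / 100" by simp
    then have "n * ((1 - M)\<^sup>2 / 10 ^ 5) \<le> n * (3 * \<Delta>\<^sup>2 / 100)" using n by (intro mult_left_mono) auto
    then show ?thesis using assms(1) by (simp add: mult.left_commute)
  qed
  with bound have bound2: "cmod (perm A) \<le> T ^ CARD('n) * exp (- (n * (1 - M)\<^sup>2 / 10 ^ 5))" by linarith
  show ?thesis
    using order_trans[OF bound double] order_trans[OF bound2 double]
    unfolding \<Delta>_def \<gamma>_def H_def M_def n_def by simp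
qed

end
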